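(* Let $r\in\mathbb{N}$, $n\in\mathbb{Z}_+$, $x\in\mathbb{Z}_p$, and $d\in\mathbb{N}$ with $d\equiv 1\pmod 2$. For $q',w'$ as below let $E_{n,w',q'}^{(r)}(y)=\int_{\mathbb{Z}_p^r} w'^{\,x_1+\cdots+x_r}[y+x_1+\cdots+x_r]_{q'}^n\,d\mu_{-1}(x_1)\cdots d\mu_{-1}(x_r)$, and define $G_{k,w',q'}^{(r)}(y)$ by $2^r t^r\sum_{m=0}^{\infty}\binom{m+r-1}{m}(-1)^m w'^{\,m} e^{t[m+y]_{q'}}=\sum_{k=0}^{\infty}G_{k,w',q'}^{(r)}(y)\frac{t^k}{k!}$. Then $$E_{n,w,q}^{(r)}(x)=[d]_q^n\sum_{a_1,\dots,a_r=0}^{d-1}\Big(\prod_{i=1}^{r}w^{a_i}\Big)(-1)^{a_1+\cdots+a_r}E_{n,w^d,q^d}^{(r)}\Big(\frac{a_1+\cdots+a_r+x}{d}\Big).$$ Furthermore, $$G_{n+r,w,q}^{(r)}(x)=[d]_q^n\sum_{a_1,\dots,a_r=0}^{d-1}\Big(\prod_{i=1}^{r}w^{a_i}\Big)(-1)^{a_1+\cdots+a_r}G_{n+r,w^d,q^d}^{(r)}\Big(\frac{a_1+\cdots+a_r+x}{d}\Big).$$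
   Context: Let $p$ be a fixed odd prime, $\mathbb{Z}_p$ the ring of $p$-adic integers, $\mathbb{C}_p$ the completion of the algebraic closure of $\mathbb{Q}_p$, and $\mathbb{Z}_+=\mathbb{N}\cup\{0\}$. Let $q,w\in\mathbb{C}_p$ with $|1-q|_p<1$ and $|1-w|_p<1$ (the pairs $(q',w')$ used are $(q,w)$ and $(q^d,w^d)$). For $x\in\mathbb{Z}_p$ put $[x]_q=\frac{1-q^x}{1-q}$. For a uniformly differentiable function $f:\mathbb{Z}_p\to\mathbb{C}_p$, the fermionic $p$-adic integral is $\int_{\mathbb{Z}_p}f(x)\,d\mu_{-1}(x)=\lim_{N\to\infty}\sum_{x=0}^{p^N-1}f(x)(-1)^x$, and $\int_{\mathbb{Z}_p^r}$ denotes the $r$-fold iterated fermionic integral.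
   Formalization: The series defining G diverges p-adically (|w|=1); its t-coefficients are read as values at z=1 of the rational function Σ a_m z^m. q^d≠1 is assumed so that [·]_q and [·]_{q^d} are defined; if (a_1+…+a_r+x)/d is not in Z_p, (q^d)^y is read as q^{dy}. *)

theory Defs
  imports "HOL-Analysis.Analysis" "HOL-Computational_Algebra.Computational_Algebra"
begin

section \<open>The field of p-adic complex numbers\<close>

text \<open>
  The field is carried by a type whose metric is the one induced by the absolute value; completeness
  is part of the class \<^class>\<open>complete_space\<close>.
\<close>

definition absp :: "'a::{field_char_0,complete_space} \<Rightarrow> real" where
  "absp x = dist x 0"

text \<open>
  Inside a complete field whose absolute value restricts to the p-adic one on the rationals, the
  completion of the rationals is their closure.
\<close>

definition Qp :: "'a::{field_char_0,complete_space} set" where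
  "Qp = closure \<rat>"

definition Zp :: "'a::{field_char_0,complete_space} set" where
  "Zp = {x \<in> Qp. absp x \<le> 1}"

definition Qp_alg :: "'a::{field_char_0,complete_space} set" where
  "Qp_alg = {x. \<exists>P. P \<noteq> 0 \<and> (\<forall>i. coeff P i \<in> Qp) \<and> poly P x = 0}"

text \<open>
  The type is a completion of an algebraic closure of the field of p-adic numbers: it is complete for
  a non-archimedean absolute value normalised by \<open>|p| = 1/p\<close> (which fixes it on the rationals), and
  the elements algebraic over \<^const>\<open>Qp\<close> form an algebraically closed dense subfield. This
  determines the valued field up to isometric isomorphism.
\<close>

definition is_Cp :: "nat \<Rightarrow> 'a::{field_char_0,complete_space} itself \<Rightarrow> bool" where
  "is_Cp p K \<longleftrightarrow>
     prime p \<and>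
     (\<forall>x y :: 'a. dist x y = absp (x - y)) \<and>
     (\<forall>x y :: 'a. absp (x * y) = absp x * absp y) \<and>
     (\<forall>x y :: 'a. absp (x + y) \<le> max (absp x) (absp y)) \<and>
     absp (of_nat p :: 'a) = 1 / real p \<and>
     (\<forall>P :: 'a poly. degree P > 0 \<longrightarrow> (\<forall>i. coeff P i \<in> Qp_alg) \<longrightarrow> (\<exists>x\<in>Qp_alg. poly P x = 0)) \<and>
     closure (Qp_alg :: 'a set) = UNIV"

section \<open>Powers with p-adic exponents\<close>

text \<open>
  For \<open>|1 - q| < 1\<close> and \<open>x\<close> in \<^const>\<open>Zp\<close>, the power \<open>q\<^sup>x\<close> is the limit of \<open>q\<^sup>k\<close> as the natural
  number \<open>k\<close> tends to \<open>x\<close> p-adically.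
\<close>

definition zp_pow :: "'a::{field_char_0,complete_space} \<Rightarrow> 'a \<Rightarrow> 'a" where
  "zp_pow q x = Lim (filtercomap of_nat (nhds x)) (\<lambda>k::nat. q ^ k)"

text \<open>
  \<open>zp_pow_base q d y\<close> is \<open>(q\<^sup>d)\<^sup>y\<close>. The arguments \<open>y = (a + x)/d\<close> with \<open>x\<close> in \<^const>\<open>Zp\<close> lie in
  \<^const>\<open>Zp\<close> whenever \<open>p\<close> does not divide \<open>d\<close>. If \<open>p\<close> divides \<open>d\<close> they need not, and then
  \<open>(q\<^sup>d)\<^sup>y\<close> has to be read as \<open>q\<close> raised to the power \<open>d y\<close>, which is again an exponent in \<^const>\<open>Zp\<close>.
\<close>

definition zp_pow_base :: "'a::{field_char_0,complete_space} \<Rightarrow> nat \<Rightarrow> 'a \<Rightarrow> 'a" where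
  "zp_pow_base q d y = (if y \<in> Zp then zp_pow (q ^ d) y else zp_pow q (of_nat d * y))"

text \<open>
  Here and below \<open>e\<close> is the map sending \<open>y\<close> to \<open>q\<^sup>y\<close>, that is \<open>zp_pow q\<close>, or \<open>zp_pow_base q d\<close> when
  the base is \<open>q\<^sup>d\<close>.
\<close>

definition q_bracket :: "'a::{field_char_0,complete_space} \<Rightarrow> ('a \<Rightarrow> 'a) \<Rightarrow> 'a \<Rightarrow> 'a" where
  "q_bracket q e y = (1 - e y) / (1 - q)"

section \<open>Fermionic integrals and twisted q-Euler polynomials of higher order\<close>

definition fermionic_integral :: "nat \<Rightarrow> ('a::{field_char_0,complete_space} \<Rightarrow> 'a) \<Rightarrow> 'a" where
  "fermionic_integral p f = lim (\<lambda>N. \<Sum>x<p ^ N. f (of_nat x) * (-1) ^ x)"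

primrec fermionic_integral_iter ::
    "nat \<Rightarrow> nat \<Rightarrow> ('a::{field_char_0,complete_space} list \<Rightarrow> 'a) \<Rightarrow> 'a" where
  "fermionic_integral_iter p 0 f = f []"
| "fermionic_integral_iter p (Suc r) f =
     fermionic_integral p (\<lambda>x. fermionic_integral_iter p r (\<lambda>xs. f (x # xs)))"

definition qEuler ::
    "nat \<Rightarrow> nat \<Rightarrow> nat \<Rightarrow> 'a::{field_char_0,complete_space} \<Rightarrow> 'a \<Rightarrow> ('a \<Rightarrow> 'a) \<Rightarrow> 'a \<Rightarrow> 'a" where
  "qEuler p r n w q e y =
     fermionic_integral_iter p r
       (\<lambda>xs. zp_pow w (sum_list xs) * q_bracket q e (y + sum_list xs) ^ n)"

section \<open>Twisted q-Genocchi polynomials of higher order\<close>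

text \<open>
  Since \<open>|w| = 1\<close>, the series over \<open>m\<close> in the generating function of the Genocchi polynomials does not
  converge p-adically. Its sum is the one given by analytic continuation in \<open>w\<close>, as in
  \<open>\<Sum>\<^sub>m (-w q\<^sup>l)\<^sup>m = 1 / (1 + w q\<^sup>l)\<close>: if the power series with coefficients \<open>a m\<close> is a rational function without pole
  at 1, the sum of the \<open>a m\<close> is the value of that function at 1. The value does not depend on the
  representation \<open>P / Q\<close>, and for a convergent series with such a generating function it is the
  ordinary sum.
\<close>

definition rational_sum :: "(nat \<Rightarrow> 'a::field) \<Rightarrow> 'a" where
  "rational_sum a = (THE s. \<exists>P Q. poly Q 1 \<noteq> 0 \<and>
     fps_of_poly Q * Abs_fps a = fps_of_poly P \<and> s = poly P 1 / poly Q 1)"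

lemma rational_sum_eqI:
  fixes a :: "nat \<Rightarrow> 'a::field"
  assumes "poly Q 1 \<noteq> 0" and "fps_of_poly Q * Abs_fps a = fps_of_poly P"
  shows "rational_sum a = poly P 1 / poly Q 1"
  unfolding rational_sum_def
proof (rule the_equality)
  show "\<exists>P' Q'. poly Q' 1 \<noteq> 0 \<and> fps_of_poly Q' * Abs_fps a = fps_of_poly P' \<and>
      poly P 1 / poly Q 1 = poly P' 1 / poly Q' 1"
    using assms by blast
next
  fix s assume "\<exists>P' Q'. poly Q' 1 \<noteq> 0 \<and> fps_of_poly Q' * Abs_fps a = fps_of_poly P' \<and>
      s = poly P' 1 / poly Q' 1"
  then obtain P' Q' where *: "poly Q' 1 \<noteq> 0" "fps_of_poly Q' * Abs_fps a = fps_of_poly P'"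
      "s = poly P' 1 / poly Q' 1" by blast
  have "fps_of_poly (Q' * P) = fps_of_poly (Q * P')"
    unfolding fps_of_poly_mult using assms(2) *(2) by (metis mult.left_commute)
  then have "Q' * P = Q * P'" by simp
  then have "poly Q' 1 * poly P 1 = poly Q 1 * poly P' 1" by (metis poly_mult)
  then show "s = poly P 1 / poly Q 1"
    unfolding *(3) using assms(1) *(1) by (simp add: frac_eq_eq mult.commute)
qed

text \<open>The sum over \<open>m\<close> of the formal power series in \<open>t\<close> is taken coefficientwise.\<close>

definition qGenocchi_gf ::
    "nat \<Rightarrow> 'a::{field_char_0,complete_space} \<Rightarrow> 'a \<Rightarrow> ('a \<Rightarrow> 'a) \<Rightarrow> 'a \<Rightarrow> 'a fps" where
  "qGenocchi_gf r w q e y =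
     2 ^ r * fps_X ^ r *
       Abs_fps (\<lambda>j. rational_sum (\<lambda>m. of_nat ((m + r - 1) choose m) * (-1) ^ m * w ^ m *
         fps_nth (fps_exp (q_bracket q e (of_nat m + y))) j))"

definition qGenocchi ::
    "nat \<Rightarrow> nat \<Rightarrow> 'a::{field_char_0,complete_space} \<Rightarrow> 'a \<Rightarrow> ('a \<Rightarrow> 'a) \<Rightarrow> 'a \<Rightarrow> 'a" where
  "qGenocchi r k w q e y = fact k * fps_nth (qGenocchi_gf r w q e y) k"

end

theory Submission imports Defs begin

text \<open>
  Expanding the \<open>n\<close>-th power of the bracket binomially and using
  \<open>\<Sum>\<^bsub>k<p^N\<^esub> (-u)\<^sup>k = (1 + u\<^bsup>p^N\<^esup>) / (1 + u) \<longlonglongrightarrow> 2 / (1 + u)\<close> for \<open>|1 - u| < 1\<close> gives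
  \<open>E\<^sub>n(y) = (1 - q)\<^bsup>-n\<^esup> \<Sum>\<^sub>l (n choose l) (-q\<^sup>y)\<^sup>l (2 / (1 + w q\<^sup>l))\<^sup>r\<close>.
  Since \<open>\<Sum>\<^sub>m (m+r-1 choose m) (-u)\<^sup>m = (1 + u)\<^bsup>-r\<^esup>\<close>, the same expansion shows
  \<open>G\<^bsub>n+r\<^esub> = (n + r)! / n! \<cdot> E\<^sub>n\<close>, so only the Euler identity is needed.
  In the closed form for \<open>(w\<^sup>d, q\<^sup>d)\<close> the sum over \<open>a\<close> is the \<open>r\<close>-th power of the geometric sum
  \<open>\<Sum>\<^bsub>k<d\<^esub> (-w q\<^sup>l)\<^sup>k = (1 + (w q\<^sup>l)\<^sup>d) / (1 + w q\<^sup>l)\<close>, whose numerator cancels the denominator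
  coming from the integral.
\<close>

section \<open>Non-archimedean absolute values\<close>

locale padic_field =
  fixes p :: nat and K :: "'a::{field_char_0,complete_space} itself"
  assumes prime_p: "prime p"
    and dist_absp: "\<And>x y :: 'a. dist x y = absp (x - y)"
    and absp_mult: "\<And>x y :: 'a. absp (x * y) = absp x * absp y"
    and absp_add_le: "\<And>x y :: 'a. absp (x + y) \<le> max (absp x) (absp y)"
    and absp_p: "absp (of_nat p :: 'a) = 1 / real p"
begin

lemma p_gt_1: "p > 1"
  using prime_p prime_gt_1_nat by blast

lemma absp_nonneg: "absp (x :: 'a) \<ge> 0"
  by (simp add: absp_def)

lemma absp_eq_0_iff: "absp (x :: 'a) = 0 \<longleftrightarrow> x = 0"
  by (simp add: absp_def)

lemma absp_one: "absp (1 :: 'a) = 1"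
  using absp_mult[of 1 1] absp_eq_0_iff[of 1] by simp

lemma absp_minus: "absp (- x :: 'a) = absp x"
  using dist_absp[of 0 x] by (simp add: absp_def dist_commute)

lemma absp_diff_commute: "absp (x - y :: 'a) = absp (y - x)"
  by (metis absp_minus minus_diff_eq)

lemma absp_diff_le: "absp (x - y :: 'a) \<le> max (absp x) (absp y)"
  using absp_add_le[of x "- y"] by (simp add: absp_minus)

lemma absp_power: "absp (x ^ n :: 'a) = absp x ^ n"
  by (induction n) (auto simp: absp_one absp_mult)

lemma absp_divide: "absp (x / y :: 'a) = absp x / absp y"
proof (cases "y = 0")
  case False
  then show ?thesis
    using absp_mult[of "x / y" y] absp_eq_0_iff[of y] by (simp add: eq_divide_eq)
qed (simp add: absp_def)

text \<open>In \<open>1 = x + (1 - x)\<close> the second term is smaller than 1, so the ultrametric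
  inequality forces the first to have absolute value 1.\<close>

lemma absp_eq_1_of_close:
  assumes "absp (1 - x :: 'a) < 1"
  shows "absp x = 1"
  using assms absp_diff_le[of 1 "1 - x"] absp_add_le[of x "1 - x"]
  by (auto simp: absp_one max_def split: if_splits)

lemma absp_of_nat_le_1: "absp (of_nat m :: 'a) \<le> 1"
proof (induction m)
  case (Suc m)
  then show ?case using absp_add_le[of 1 "of_nat m"] by (auto simp: absp_one)
qed (simp add: absp_def)

lemma absp_of_int_le_1: "absp (of_int z :: 'a) \<le> 1"
  by (cases z) (auto simp: absp_of_nat_le_1 absp_minus simp del: of_nat_Suc)

text \<open>By Bezout \<open>z\<close> has an inverse \<open>u\<close> modulo \<open>p\<close>, so
  \<open>u * z\<close> is close to 1 and has absolute value 1; as neither factor exceeds 1, both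
  equal 1.\<close>

lemma absp_of_int_eq_1:
  assumes "\<not> int p dvd z"
  shows "absp (of_int z :: 'a) = 1"
proof -
  have "coprime z (int p)"
    using prime_p assms prime_imp_coprime[of "int p" z] by (simp add: coprime_commute)
  then obtain u v where uv: "u * z + v * int p = 1"
    using bezout_int[of z "int p"] by auto
  have "(1::'a) - of_int (u * z) = of_int v * of_nat p"
    using arg_cong[OF uv, of "of_int :: int \<Rightarrow> 'a"] by (simp add: algebra_simps)
  then have "absp ((1::'a) - of_int (u * z)) = absp (of_int v :: 'a) / real p"
    by (simp add: absp_mult absp_p)
  also have "\<dots> < 1"
    using p_gt_1 absp_of_int_le_1[of v] by (simp add: field_simps)
  finally have "absp (of_int u * of_int z :: 'a) = 1"
    using absp_eq_1_of_close by simp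
  then have eq: "absp (of_int u :: 'a) * absp (of_int z :: 'a) = 1"
    by (simp add: absp_mult)
  have "absp (of_int u :: 'a) * absp (of_int z :: 'a) \<le> 1 * absp (of_int z :: 'a)"
    by (intro mult_right_mono absp_of_int_le_1 absp_nonneg)
  with eq show ?thesis using absp_of_int_le_1[of z] by linarith
qed

text \<open>Splitting off the exact power of \<open>p\<close> computes the absolute value of an
  integer. With the converse below, p-adic closeness of integers becomes congruence modulo
  \<open>p ^ N\<close>.\<close>

lemma power_dvd_of_absp_le:
  assumes "absp (of_int z :: 'a) \<le> (1 / real p) ^ N"
  shows "int p ^ N dvd z"
proof (cases "z = 0")
  case False
  define v where "v = multiplicity (int p) z"
  have "\<not> is_unit (int p)" using p_gt_1 by simp
  with False obtain y where y: "z = int p ^ v * y" "\<not> int p dvd y"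
    using multiplicity_decompose'[of z "int p"] unfolding v_def by metis
  have "absp (of_int z :: 'a) = (1 / real p) ^ v"
    using absp_of_int_eq_1[OF y(2)] by (simp add: y(1) absp_mult absp_power absp_p)
  with assms have "(1 / real p) ^ v \<le> (1 / real p) ^ N" by simp
  then have "real p ^ N \<le> real p ^ v"
    using p_gt_1 by (simp add: field_simps)
  then have "N \<le> v" using p_gt_1 by simp
  then show ?thesis unfolding y(1) by (simp add: le_imp_power_dvd)
qed simp

lemma absp_of_int_le_of_power_dvd:
  assumes "int p ^ N dvd z"
  shows "absp (of_int z :: 'a) \<le> (1 / real p) ^ N"
proof -
  from assms obtain y where "z = int p ^ N * y" by blast
  then have "absp (of_int z :: 'a) = (1 / real p) ^ N * absp (of_int y :: 'a)"
    by (simp add: absp_mult absp_power absp_p)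
  then show ?thesis
    using absp_of_int_le_1[of y] by (simp add: mult_left_le)
qed

section \<open>Density of the natural numbers in the p-adic integers\<close>

lemma inverse_p_power_tendsto_0: "(\<lambda>N. (1 / real p) ^ N) \<longlonglongrightarrow> 0"
  using p_gt_1 by (intro LIMSEQ_power_zero) auto

lemma rational_near_nat:
  assumes "x \<in> \<rat>" "absp (x :: 'a) \<le> 1" "e > 0"
  shows "\<exists>k::nat. absp (x - of_nat k) < e"
proof -
  from \<open>x \<in> \<rat>\<close> obtain a b :: int where ab: "b > 0" "coprime a b" "x = of_int a / of_int b"
    by (rule Rats_cases')
  \<comment> \<open>In lowest terms, a denominator divisible by \<open>p\<close> leaves a unit
    numerator, which would make \<open>absp x\<close> exceed 1.\<close>
  have "\<not> int p dvd b"
  proof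
    assume "int p dvd b"
    have "absp (of_int b :: 'a) \<le> 1 / real p"
      using absp_of_int_le_of_power_dvd[of 1 b] \<open>int p dvd b\<close> by simp
    also have "\<dots> < 1" using p_gt_1 by simp
    finally have "absp (of_int b :: 'a) < 1" .
    moreover have "\<not> int p dvd a"
      using \<open>int p dvd b\<close> ab(2) p_gt_1 coprime_common_divisor[of a b "int p"] by auto
    then have "absp (of_int a :: 'a) = 1" by (rule absp_of_int_eq_1)
    moreover have "absp (of_int b :: 'a) > 0"
      using ab(1) absp_nonneg[of "of_int b"] absp_eq_0_iff[of "of_int b"] by auto
    ultimately show False
      using assms(2) by (simp add: ab(3) absp_divide)
  qed
  then have b1: "absp (of_int b :: 'a) = 1" by (rule absp_of_int_eq_1)
  obtain N where N: "(1 / real p) ^ N < e"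
    using order_tendstoD(2)[OF inverse_p_power_tendsto_0 \<open>e > 0\<close>]
    by (auto simp: eventually_sequentially)
  have "coprime b (int p ^ N)"
    using \<open>\<not> int p dvd b\<close> prime_p prime_imp_coprime[of "int p" b]
    by (simp add: coprime_commute)
  then obtain u v where uv: "u * b + v * int p ^ N = 1"
    using bezout_int[of b "int p ^ N"] by auto
  \<comment> \<open>Since \<open>u\<close> inverts \<open>b\<close> modulo \<open>p ^ N\<close>, the
    residue of \<open>a * u\<close> is the natural number congruent to \<open>a / b\<close>.\<close>
  define k where "k = nat ((a * u) mod int p ^ N)"
  have k: "int k = (a * u) mod int p ^ N"
    using p_gt_1 by (simp add: k_def)
  have "int p ^ N dvd a * u - int k"
    unfolding k by (simp add: mod_eq_dvd_iff [symmetric])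
  then have "int p ^ N dvd b * (a * u - int k) + a * (v * int p ^ N)"
    by (intro dvd_add) auto
  also have "b * (a * u - int k) + a * (v * int p ^ N) = a * (u * b + v * int p ^ N) - b * int k"
    by (simp add: algebra_simps)
  finally have dvd: "int p ^ N dvd a - b * int k" using uv by simp
  have "x - of_nat k = of_int (a - b * int k) / of_int b"
    using ab(1) by (simp add: ab(3) field_simps)
  then have "absp (x - of_nat k) = absp (of_int (a - b * int k) :: 'a)"
    by (simp only: absp_divide b1 div_by_1)
  also have "\<dots> \<le> (1 / real p) ^ N" by (rule absp_of_int_le_of_power_dvd[OF dvd])
  finally show ?thesis using N le_less_trans by blast
qed

lemma Zp_subset_closure_nat: "(Zp :: 'a set) \<subseteq> closure (range of_nat)"
proof
  fix x :: 'a assume x: "x \<in> Zp"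
  show "x \<in> closure (range of_nat)"
    unfolding closure_approachable
  proof (intro allI impI)
    fix e :: real assume "e > 0"
    \<comment> \<open>The bound 1 keeps the rational approximant in the unit ball, as
      \<open>rational_near_nat\<close> requires.\<close>
    then have "min e 1 > 0" by simp
    with x obtain y where y: "y \<in> \<rat>" "dist y x < min e 1"
      unfolding Zp_def Qp_def closure_approachable by blast
    have xy: "absp (y - x) < min e 1" using y(2) by (simp add: dist_absp)
    have "absp y \<le> 1"
      using absp_add_le[of "y - x" x] xy x by (auto simp: Zp_def)
    with y(1) \<open>e > 0\<close> obtain k :: nat where "absp (y - of_nat k) < e"
      using rational_near_nat by blast
    moreover have "of_nat k - x = (y - x) - (y - of_nat k)" by simp
    ultimately have "absp (of_nat k - x) < e"
      using absp_diff_le[of "y - x" "y - of_nat k"] xy by (simp add: max_def split: if_splits)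
    then show "\<exists>y\<in>range of_nat. dist y x < e" by (auto simp: dist_absp)
  qed
qed

lemma of_nat_in_Zp: "(of_nat k :: 'a) \<in> Zp"
  using closure_subset[of "\<rat> :: 'a set"] by (auto simp: Zp_def Qp_def absp_of_nat_le_1)

lemma Zp_limit_of_nats:
  assumes "(x :: 'a) \<in> Zp"
  obtains k :: "nat \<Rightarrow> nat" where "(\<lambda>i. of_nat (k i)) \<longlonglongrightarrow> x"
proof -
  have "x \<in> closure (range of_nat)" using assms Zp_subset_closure_nat by blast
  then obtain f where f: "\<forall>i. f i \<in> range of_nat" "f \<longlonglongrightarrow> x"
    unfolding closure_sequential by blast
  then have "\<forall>i. \<exists>k. f i = of_nat k" by blast
  then obtain k where "f = (\<lambda>i. of_nat (k i))" by metis
  with f(2) that show thesis by blast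
qed

text \<open>The type class does not tie the metric to the ring operations, so the limit laws are
  derived from the properties of \<open>absp\<close>.\<close>

lemma tendsto_const_mult:
  assumes "(f \<longlongrightarrow> (l::'a)) F"
  shows "((\<lambda>x. c * f x) \<longlongrightarrow> c * l) F"
proof -
  have "((\<lambda>x. absp c * dist (f x) l) \<longlongrightarrow> absp c * 0) F"
    by (intro tendsto_mult tendsto_const iffD1[OF tendsto_dist_iff] assms)
  moreover have "absp c * dist (f x) l = dist (c * f x) (c * l)" for x
    by (simp add: dist_absp absp_mult [symmetric] right_diff_distrib)
  ultimately show ?thesis by (simp add: tendsto_dist_iff[of _ "c * l"])
qed

lemma tendsto_plus:
  assumes "(f \<longlongrightarrow> (l::'a)) F" "(g \<longlongrightarrow> m) F"
  shows "((\<lambda>x. f x + g x) \<longlongrightarrow> l + m) F"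
proof -
  have lim: "((\<lambda>x. max (dist (f x) l) (dist (g x) m)) \<longlongrightarrow> max 0 0) F"
    by (intro tendsto_max iffD1[OF tendsto_dist_iff] assms)
  have le: "dist (f x + g x) (l + m) \<le> max (dist (f x) l) (dist (g x) m)" for x
    using absp_add_le[of "f x - l" "g x - m"] by (simp add: dist_absp algebra_simps)
  have "((\<lambda>x. dist (f x + g x) (l + m)) \<longlongrightarrow> 0) F"
    by (rule tendsto_sandwich[OF _ always_eventually tendsto_const lim[simplified]])
      (auto intro!: le[simplified])
  then show ?thesis by (simp add: tendsto_dist_iff[of _ "l + m"])
qed

lemma tendsto_finite_sum:
  assumes "\<And>i. i \<in> A \<Longrightarrow> (f i \<longlongrightarrow> (l i::'a)) F"
  shows "((\<lambda>x. \<Sum>i\<in>A. f i x) \<longlongrightarrow> (\<Sum>i\<in>A. l i)) F"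
  using assms by (induction A rule: infinite_finite_induct) (auto intro: tendsto_plus)

section \<open>Powers of elements close to 1\<close>

lemma absp_sum_le:
  assumes "\<And>i. i \<in> A \<Longrightarrow> absp (f i :: 'a) \<le> c" "c \<ge> 0"
  shows "absp (\<Sum>i\<in>A. f i) \<le> c"
  using assms
proof (induction A rule: infinite_finite_induct)
  case (insert i A)
  then show ?case using absp_add_le[of "f i" "sum f A"] by fastforce
qed (auto simp: absp_def)

text \<open>The cofactor of \<open>1 - u\<close> in \<open>1 - u ^ m\<close> is a geometric sum of
  elements of absolute value 1, hence lies in the unit ball.\<close>

lemma absp_one_minus_power_le:
  assumes "absp (1 - u :: 'a) < 1"
  shows "absp (1 - u ^ m) \<le> absp (1 - u)"
proof -
  have "absp (\<Sum>i<m. u ^ i) \<le> 1"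
    by (intro absp_sum_le) (simp_all add: absp_power absp_eq_1_of_close[OF assms])
  then show ?thesis
    using absp_nonneg[of "1 - u"] by (simp add: one_diff_power_eq absp_mult mult_left_le)
qed

lemma absp_one_minus_mult:
  assumes "absp (1 - u :: 'a) < 1" "absp (1 - v) < 1"
  shows "absp (1 - u * v) < 1"
proof -
  have "1 - u * v = (1 - u) + u * (1 - v)" by (simp add: algebra_simps)
  then have "absp (1 - u * v) \<le> max (absp (1 - u)) (absp (u * (1 - v)))"
    using absp_add_le by metis
  with assms absp_eq_1_of_close[OF assms(1)] show ?thesis by (simp add: absp_mult)
qed

text \<open>Each p-th power gains a factor \<open>c\<close>: the cofactor of \<open>1 - v\<close> in
  \<open>1 - v ^ p\<close> is a sum of \<open>p\<close> terms close to 1, so it differs from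
  \<open>p\<close> by at most \<open>c\<close>, and \<open>p\<close> itself has size
  \<open>1 / p\<close>, again at most \<open>c\<close>.\<close>

lemma absp_one_minus_power_p_power_le:
  assumes "absp (1 - u :: 'a) \<le> c" "1 / real p \<le> c" "c < 1"
  shows "absp (1 - u ^ (p ^ N)) \<le> c ^ Suc N"
proof (induction N)
  case (Suc N)
  define v where "v = u ^ (p ^ N)"
  have u: "absp (1 - u) < 1" using assms by simp
  have vc: "absp (1 - v) \<le> c"
    using absp_one_minus_power_le[OF u, of "p ^ N"] assms(1) unfolding v_def by linarith
  have v: "absp (1 - v) < 1" using vc assms(3) by simp
  have "(\<Sum>i<p. v ^ i) = of_nat p - (\<Sum>i<p. 1 - v ^ i)" by (simp add: sum_subtractf)
  moreover have "absp (\<Sum>i<p. 1 - v ^ i) \<le> c"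
    using order_trans[OF absp_one_minus_power_le[OF v] vc] order_trans[OF absp_nonneg vc]
    by (intro absp_sum_le) auto
  ultimately have "absp (\<Sum>i<p. v ^ i) \<le> c"
    using absp_diff_le[of "of_nat p" "\<Sum>i<p. 1 - v ^ i"] assms(2) by (simp add: absp_p)
  moreover have "u ^ p ^ Suc N = v ^ p"
    by (simp add: v_def power_mult [symmetric] mult.commute)
  then have "1 - u ^ p ^ Suc N = (1 - v) * (\<Sum>i<p. v ^ i)"
    by (simp only: one_diff_power_eq)
  moreover have "absp (1 - v) \<le> c ^ Suc N" using Suc v_def by simp
  ultimately have "absp (1 - u ^ p ^ Suc N) \<le> c ^ Suc N * c"
    using mult_mono[of "absp (1 - v)" "c ^ Suc N" "absp (\<Sum>i<p. v ^ i)" c] absp_nonneg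
      order_trans[OF absp_nonneg vc]
    by (simp add: absp_mult)
  then show ?case by (simp add: mult_ac)
qed (use assms in simp)

lemma power_p_power_tendsto_1:
  assumes "absp (1 - u :: 'a) < 1"
  shows "(\<lambda>N. u ^ (p ^ N)) \<longlonglongrightarrow> 1"
proof -
  define c where "c = max (absp (1 - u)) (1 / real p)"
  have c: "absp (1 - u) \<le> c" "1 / real p \<le> c" "c < 1" "0 \<le> c"
    using assms p_gt_1 by (auto simp: c_def le_max_iff_disj)
  have lim: "(\<lambda>N. c ^ Suc N) \<longlonglongrightarrow> 0"
    using c by (intro LIMSEQ_Suc LIMSEQ_power_zero) auto
  have "dist (u ^ (p ^ N)) 1 \<le> c ^ Suc N" for N
    unfolding dist_absp absp_diff_commute[of _ 1]
    by (rule absp_one_minus_power_p_power_le[OF c(1-3)])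
  then have "(\<lambda>N. dist (u ^ (p ^ N)) 1) \<longlonglongrightarrow> 0"
    by (intro tendsto_sandwich[OF _ always_eventually tendsto_const lim]) simp_all
  then show ?thesis by (simp add: tendsto_dist_iff[of _ 1])
qed

section \<open>Powers with exponents in the p-adic integers\<close>

text \<open>If \<open>j\<close> and \<open>k\<close> agree modulo \<open>p ^ N\<close>, the
  difference of the powers is a unit times \<open>1 - (q ^ (p ^ N)) ^ m\<close>, which is small for
  large \<open>N\<close>. Uniformity is what permits extension to the closure of the
  naturals.\<close>

lemma power_uniformly_continuous:
  assumes q: "absp (1 - q :: 'a) < 1" and "e > 0"
  shows "\<exists>\<delta>>0. \<forall>j k :: nat. absp (of_nat j - of_nat k :: 'a) < \<delta> \<longrightarrow> absp (q ^ j - q ^ k) < e"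
proof -
  have "eventually (\<lambda>N. dist (q ^ (p ^ N)) 1 < e) sequentially"
    using power_p_power_tendsto_1[OF q] \<open>e > 0\<close> by (rule tendstoD)
  then obtain N where "dist (q ^ (p ^ N)) 1 < e"
    by (auto simp: eventually_sequentially)
  then have N: "absp (1 - q ^ (p ^ N)) < e"
    by (simp add: dist_absp absp_diff_commute)
  have qN: "absp (1 - q ^ (p ^ N)) < 1"
    using absp_one_minus_power_le[OF q] q by (rule le_less_trans)
  have *: "absp (q ^ j - q ^ k) < e"
    if "absp (of_nat j - of_nat k :: 'a) < (1 / real p) ^ N" "j \<le> k" for j k :: nat
  proof -
    have "absp (of_int (int j - int k) :: 'a) \<le> (1 / real p) ^ N" using that by simp
    then have "int p ^ N dvd int j - int k" by (rule power_dvd_of_absp_le)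
    then have "int (p ^ N) dvd int (k - j)"
      using that(2) by (simp add: of_nat_diff dvd_diff_commute)
    then have "p ^ N dvd k - j" by (simp only: int_dvd_int_iff)
    then obtain m where "k - j = p ^ N * m" by blast
    then have m: "k = j + p ^ N * m" using that(2) by linarith
    have "q ^ j - q ^ k = q ^ j * (1 - (q ^ (p ^ N)) ^ m)"
      by (simp add: m power_add power_mult right_diff_distrib)
    then have "absp (q ^ j - q ^ k) = absp (1 - (q ^ (p ^ N)) ^ m)"
      by (simp add: absp_mult absp_power absp_eq_1_of_close[OF q])
    then show ?thesis using absp_one_minus_power_le[OF qN, of m] N by simp
  qed
  have "absp (q ^ j - q ^ k) < e"
    if "absp (of_nat j - of_nat k :: 'a) < (1 / real p) ^ N" for j k :: nat
    using *[of j k] *[of k j] that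
    by (metis absp_diff_commute nat_le_linear)
  then show ?thesis using p_gt_1 by (intro exI[of _ "(1 / real p) ^ N"]) auto
qed

text \<open>Justifies the \<open>Lim\<close> in \<open>zp_pow\<close>: by completeness, the
  uniformly continuous exponential on the naturals extends continuously to their closure, which
  contains \<open>Zp\<close>.\<close>

lemma zp_pow_tendsto:
  assumes q: "absp (1 - q :: 'a) < 1" and x: "x \<in> Zp"
  shows "((\<lambda>k::nat. q ^ k) \<longlongrightarrow> zp_pow q x) (filtercomap of_nat (nhds x))"
proof -
  \<comment> \<open>Moves the exponential from \<open>nat\<close> to the image of \<open>nat\<close>
    in the field; \<open>of_nat\<close> is injective in characteristic 0.\<close>
  define f :: "'a \<Rightarrow> 'a" where "f y = q ^ (inv of_nat y :: nat)" for y
  have f: "f (of_nat k) = q ^ k" for k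
    unfolding f_def by (simp add: inv_f_f inj_of_nat)
  have "uniformly_continuous_on (range of_nat) f"
    unfolding uniformly_continuous_on_def
  proof (intro allI impI)
    fix e :: real assume "e > 0"
    then obtain \<delta> where \<delta>: "\<delta> > 0"
        "\<And>j k. absp (of_nat j - of_nat k :: 'a) < \<delta> \<Longrightarrow> absp (q ^ j - q ^ k) < e"
      using power_uniformly_continuous[OF q] by meson
    then show "\<exists>\<delta>>0. \<forall>y\<in>range of_nat. \<forall>y'\<in>range of_nat. dist y' y < \<delta> \<longrightarrow> dist (f y') (f y) < e"
      by (intro exI[of _ \<delta>]) (auto simp: f dist_absp)
  qed
  then obtain g where g: "uniformly_continuous_on (closure (range of_nat)) g"
      "\<And>y. y \<in> range of_nat \<Longrightarrow> f y = g y"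
    using uniformly_continuous_on_extension_on_closure by metis
  have xc: "x \<in> closure (range of_nat)" using x Zp_subset_closure_nat by blast
  have "((\<lambda>k::nat. g (of_nat k)) \<longlongrightarrow> g x) (filtercomap of_nat (nhds x))"
  proof (rule continuous_on_tendsto_compose[OF uniformly_continuous_imp_continuous[OF g(1)] _ xc])
    show "filterlim of_nat (nhds x) (filtercomap of_nat (nhds x))" by (rule filterlim_filtercomap)
    show "\<forall>\<^sub>F k in filtercomap of_nat (nhds x). of_nat k \<in> closure (range of_nat)"
      using closure_subset[of "range of_nat"] by (intro always_eventually) auto
  qed
  then have lim: "((\<lambda>k::nat. q ^ k) \<longlongrightarrow> g x) (filtercomap of_nat (nhds x))"
    by (simp add: g(2) [symmetric] f)
  \<comment> \<open>Density of the naturals makes the filter proper, so that the limit is unique and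
    \<open>Lim\<close> returns it.\<close>
  have "filtercomap (of_nat :: nat \<Rightarrow> 'a) (nhds x) \<noteq> bot"
  proof (rule filtercomap_neq_bot)
    fix P :: "'a \<Rightarrow> bool" assume "eventually P (nhds x)"
    then obtain S where "open S" "x \<in> S" "\<forall>y\<in>S. P y" by (auto simp: eventually_nhds)
    moreover from this xc have "S \<inter> range of_nat \<noteq> {}"
      using open_Int_closure_eq_empty[of S "range of_nat"] by blast
    ultimately show "\<exists>k. P (of_nat k)" by blast
  qed
  with lim have "zp_pow q x = g x" unfolding zp_pow_def by (intro tendsto_Lim)
  with lim show ?thesis by simp
qed

lemma zp_pow_sequence:
  assumes "absp (1 - q :: 'a) < 1" "x \<in> Zp" "(\<lambda>i. of_nat (k i)) \<longlonglongrightarrow> x"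
  shows "(\<lambda>i. q ^ k i) \<longlonglongrightarrow> zp_pow q x"
  using assms(3) by (intro filterlim_compose[OF zp_pow_tendsto[OF assms(1,2)]])
    (simp add: filterlim_filtercomap_iff o_def)

lemma zp_pow_of_nat:
  assumes "absp (1 - q :: 'a) < 1"
  shows "zp_pow q (of_nat k) = q ^ k"
  using zp_pow_sequence[OF assms of_nat_in_Zp tendsto_const] by (simp add: LIMSEQ_const_iff)

lemma Zp_add_of_nat:
  assumes "(x :: 'a) \<in> Zp"
  shows "x + of_nat s \<in> Zp"
proof -
  from assms obtain f where f: "\<And>i. f i \<in> \<rat>" "f \<longlonglongrightarrow> x"
    unfolding Zp_def Qp_def closure_sequential by auto
  have "(\<lambda>i. f i + of_nat s) \<longlonglongrightarrow> x + of_nat s" by (intro tendsto_plus f(2) tendsto_const)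
  then have "x + of_nat s \<in> Qp"
    unfolding Qp_def closure_sequential using f(1) by (metis Rats_add Rats_of_nat)
  moreover have "absp (x + of_nat s) \<le> 1"
    using absp_add_le[of x "of_nat s"] absp_of_nat_le_1[of s] assms by (auto simp: Zp_def)
  ultimately show ?thesis by (simp add: Zp_def)
qed

text \<open>Natural shifts suffice, because the fermionic sums and the Genocchi series move the
  argument by natural numbers only.\<close>

lemma zp_pow_add_of_nat:
  assumes "absp (1 - q :: 'a) < 1" "x \<in> Zp"
  shows "zp_pow q (x + of_nat s) = zp_pow q x * q ^ s"
proof -
  obtain k :: "nat \<Rightarrow> nat" where k: "(\<lambda>i. of_nat (k i)) \<longlonglongrightarrow> x"
    using Zp_limit_of_nats[OF assms(2)] .
  have "(\<lambda>i. of_nat (k i + s)) \<longlonglongrightarrow> x + of_nat s"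
    unfolding of_nat_add by (intro tendsto_plus k tendsto_const)
  then have "(\<lambda>i. q ^ (k i + s)) \<longlonglongrightarrow> zp_pow q (x + of_nat s)"
    by (rule zp_pow_sequence[OF assms(1) Zp_add_of_nat[OF assms(2)]])
  moreover have "(\<lambda>i. q ^ s * q ^ k i) \<longlonglongrightarrow> q ^ s * zp_pow q x"
    by (intro tendsto_const_mult zp_pow_sequence assms k)
  ultimately show ?thesis
    using LIMSEQ_unique by (fastforce simp: power_add mult.commute)
qed

text \<open>The two branches of \<open>zp_pow_base\<close> agree where both make sense: along
  naturals tending to \<open>y\<close>, both powers are limits of \<open>q ^ (d * k i)\<close>. No
  case distinction on whether \<open>p\<close> divides \<open>d\<close> is needed
  afterwards.\<close>

lemma zp_pow_base_eq:
  assumes "absp (1 - q :: 'a) < 1" "of_nat d * y \<in> Zp"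
  shows "zp_pow_base q d y = zp_pow q (of_nat d * y)"
proof (cases "y \<in> Zp")
  case True
  have qd: "absp (1 - q ^ d) < 1"
    using absp_one_minus_power_le[OF assms(1), of d] assms(1) by simp
  obtain k :: "nat \<Rightarrow> nat" where k: "(\<lambda>i. of_nat (k i)) \<longlonglongrightarrow> y"
    using Zp_limit_of_nats[OF True] .
  have "(\<lambda>i. of_nat (d * k i)) \<longlonglongrightarrow> of_nat d * y"
    unfolding of_nat_mult by (intro tendsto_const_mult k)
  then have "(\<lambda>i. q ^ (d * k i)) \<longlonglongrightarrow> zp_pow q (of_nat d * y)"
    by (rule zp_pow_sequence[OF assms])
  moreover have "(\<lambda>i. (q ^ d) ^ k i) \<longlonglongrightarrow> zp_pow (q ^ d) y"
    by (rule zp_pow_sequence[OF qd True k])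
  ultimately show ?thesis
    using True LIMSEQ_unique by (auto simp: zp_pow_base_def power_mult)
qed (simp add: zp_pow_base_def)

lemma zp_pow_base_quotient:
  assumes q: "absp (1 - q :: 'a) < 1" and x: "x \<in> Zp" and d: "d > 0"
  shows "zp_pow_base q d ((of_nat S + x) / of_nat d + of_nat s) = zp_pow q x * q ^ (S + d * s)"
proof -
  have "of_nat d * ((of_nat S + x) / of_nat d + of_nat s) = x + of_nat (S + d * s)"
    using d by (simp add: field_simps)
  then show ?thesis
    using zp_pow_base_eq[OF q, of d "(of_nat S + x) / of_nat d + of_nat s"]
      Zp_add_of_nat[OF x, of "S + d * s"] zp_pow_add_of_nat[OF q x, of "S + d * s"] by simp
qed

section \<open>Fermionic integrals of exponentials\<close>

text \<open>Otherwise \<open>1 - u\<close> would be 2, a p-adic unit for odd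
  \<open>p\<close>.\<close>

lemma one_plus_nonzero:
  assumes "odd p" "absp (1 - u :: 'a) < 1"
  shows "1 + u \<noteq> 0"
proof
  assume "1 + u = 0"
  then have "u = - 1" by (simp add: eq_neg_iff_add_eq_0 add.commute)
  then have "1 - u = of_int 2" by simp
  moreover have "\<not> int p dvd 2"
    using assms(1) p_gt_1 zdvd_imp_le[of "int p" 2] by (cases "p = 2") auto
  ultimately show False using assms(2) absp_of_int_eq_1[of 2] by (simp only:) simp
qed

lemma fermionic_sum_tendsto:
  assumes "odd p" "absp (1 - u :: 'a) < 1"
  shows "(\<lambda>N. \<Sum>k<p ^ N. u ^ k * (-1) ^ k) \<longlonglongrightarrow> 2 / (1 + u)"
proof -
  have nz: "1 + u \<noteq> 0" using one_plus_nonzero[OF assms] .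
  have eq: "(\<Sum>k<p ^ N. u ^ k * (-1) ^ k) = inverse (1 + u) * (1 + u ^ (p ^ N))" for N
  proof -
    \<comment> \<open>Oddness turns the alternating geometric sum's numerator
      \<open>1 - (- u) ^ (p ^ N)\<close> into \<open>1 + u ^ (p ^ N)\<close>.\<close>
    have "odd (p ^ N)" using assms(1) by simp
    have "1 + u ^ (p ^ N) = 1 - (- u) ^ (p ^ N)"
      using \<open>odd (p ^ N)\<close> by (metis diff_minus_eq_add power_minus_odd)
    also have "\<dots> = (1 + u) * (\<Sum>k<p ^ N. (- u) ^ k)"
      by (simp add: one_diff_power_eq)
    also have "(\<Sum>k<p ^ N. (- u) ^ k) = (\<Sum>k<p ^ N. u ^ k * (-1) ^ k)"
      by (intro sum.cong refl) (metis mult_minus1_right power_mult_distrib)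
    finally show ?thesis using nz by (simp add: field_simps)
  qed
  have "(\<lambda>N. inverse (1 + u) * (1 + u ^ (p ^ N))) \<longlonglongrightarrow> inverse (1 + u) * (1 + 1)"
    by (intro tendsto_const_mult tendsto_plus tendsto_const power_p_power_tendsto_1 assms)
  then show ?thesis unfolding eq by (simp add: field_simps)
qed

text \<open>Each integration contributes a factor \<open>2 / (1 + u l)\<close> to the term of
  \<open>l\<close>. The integrand is constrained only at lists of naturals, the only points that the
  defining sums sample.\<close>

lemma fermionic_integral_iter_exponential_sum:
  assumes p: "odd p" and u: "\<And>l. l \<in> L \<Longrightarrow> absp (1 - u l :: 'a) < 1"
    and f: "\<And>ks. length ks = r \<Longrightarrow> f (map of_nat ks) = (\<Sum>l\<in>L. c l * u l ^ sum_list ks)"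
  shows "fermionic_integral_iter p r f = (\<Sum>l\<in>L. c l * (2 / (1 + u l)) ^ r)"
  using f
\<comment> \<open>The coefficients vary because fixing the first variable at \<open>k\<close>
  multiplies \<open>c l\<close> by \<open>u l ^ k\<close>.\<close>
proof (induction r arbitrary: f c)
  case 0
  then show ?case using "0.prems"[of "[]"] by simp
next
  case (Suc r)
  have inner: "fermionic_integral_iter p r (\<lambda>xs. f (of_nat k # xs)) =
      (\<Sum>l\<in>L. c l * u l ^ k * (2 / (1 + u l)) ^ r)" for k
  proof (rule Suc.IH)
    fix ks :: "nat list" assume "length ks = r"
    then show "f (of_nat k # map of_nat ks) = (\<Sum>l\<in>L. c l * u l ^ k * u l ^ sum_list ks)"
      using Suc.prems[of "k # ks"] by (simp add: power_add mult.assoc)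
  qed
  have "(\<Sum>k<p ^ N. fermionic_integral_iter p r (\<lambda>xs. f (of_nat k # xs)) * (-1) ^ k) =
      (\<Sum>l\<in>L. c l * (2 / (1 + u l)) ^ r * (\<Sum>k<p ^ N. u l ^ k * (-1) ^ k))" for N
    unfolding inner sum_distrib_left sum_distrib_right
    by (subst sum.swap) (simp add: mult_ac)
  moreover have "(\<lambda>N. \<Sum>l\<in>L. c l * (2 / (1 + u l)) ^ r * (\<Sum>k<p ^ N. u l ^ k * (-1) ^ k))
      \<longlonglongrightarrow> (\<Sum>l\<in>L. c l * (2 / (1 + u l)) ^ r * (2 / (1 + u l)))"
    by (intro tendsto_finite_sum tendsto_const_mult fermionic_sum_tendsto p u)
  ultimately show ?case
    by (simp add: fermionic_integral_def limI mult_ac)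
qed

end

section \<open>Binomial expansions and formal summation\<close>

lemma q_bracket_power_expand:
  fixes e :: "'a::{field_char_0,complete_space} \<Rightarrow> 'a"
  assumes "e (y + of_nat s) = e y * q ^ s"
  shows "q_bracket q e (y + of_nat s) ^ n =
    (\<Sum>l\<le>n. of_nat (n choose l) * (- e y) ^ l / (1 - q) ^ n * (q ^ l) ^ s)"
proof -
  have "(1 - e y * q ^ s) ^ n = (- (e y * q ^ s) + 1) ^ n" by simp
  also have "\<dots> = (\<Sum>l\<le>n. of_nat (n choose l) * (- (e y * q ^ s)) ^ l)"
    by (subst binomial_ring) simp
  also have "\<dots> = (\<Sum>l\<le>n. of_nat (n choose l) * (- e y) ^ l * (q ^ l) ^ s)"
    by (intro sum.cong refl)
      (simp add: power_minus[of "_ * _"] power_minus[of "e y"] power_mult_distrib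
        power_mult [symmetric] mult.commute[of s])
  finally show ?thesis
    unfolding q_bracket_def assms power_divide by (simp add: sum_divide_distrib)
qed

text \<open>The negative binomial series: multiplying by \<open>1 + u X\<close> lowers
  \<open>r\<close> by one, by Pascal's rule.\<close>

lemma binomial_geometric_fps:
  fixes u :: "'a::field_char_0"
  shows "fps_of_poly ([:1, u:] ^ r) *
    Abs_fps (\<lambda>m. of_nat ((m + r - 1) choose m) * (- u) ^ m) = 1"
proof (induction r)
  case 0
  \<comment> \<open>Truncated subtraction gives \<open>0 choose 0 = 1\<close> at
    \<open>m = 0\<close>, so for \<open>r = 0\<close> the series is the constant 1.\<close>
  have "(m - 1) choose m = (if m = 0 then 1 else 0)" for m :: nat
    by (cases m) (simp_all add: binomial_eq_0)
  then show ?case by (auto simp: fps_eq_iff)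
next
  case (Suc r)
  define F where "F r = Abs_fps (\<lambda>m. of_nat ((m + r - 1) choose m) * (- u) ^ m)" for r
  have "fps_of_poly [:1, u:] * F (Suc r) = F r"
  proof (rule fps_ext)
    fix m
    show "fps_nth (fps_of_poly [:1, u:] * F (Suc r)) m = fps_nth (F r) m"
      by (cases m) (auto simp: F_def fps_of_poly_pCons distrib_right mult.assoc algebra_simps)
  qed
  then have "fps_of_poly ([:1, u:] ^ Suc r) * F (Suc r) = fps_of_poly ([:1, u:] ^ r) * F r"
    by (simp only: power_Suc2 fps_of_poly_mult mult.assoc)
  with Suc show ?case unfolding F_def by simp
qed

text \<open>A finite combination of negative binomial series is a rational function with common
  denominator \<open>prod Q L\<close>, nonzero at 1; evaluating there gives the combination of the
  individual values.\<close>

lemma rational_sum_binomial_geometric: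
  fixes u :: "'b \<Rightarrow> 'a::field_char_0"
  assumes "finite L" "\<And>l. l \<in> L \<Longrightarrow> 1 + u l \<noteq> 0"
  shows "rational_sum (\<lambda>m. \<Sum>l\<in>L. c l * (of_nat ((m + r - 1) choose m) * (- u l) ^ m)) =
    (\<Sum>l\<in>L. c l / (1 + u l) ^ r)"
proof -
  define Q where "Q l = [:1, u l:] ^ r" for l
  define F where "F l = Abs_fps (\<lambda>m. of_nat ((m + r - 1) choose m) * (- u l) ^ m)" for l
  have Q1: "poly (Q l) 1 = (1 + u l) ^ r" for l by (simp add: Q_def)
  have QF: "fps_of_poly (Q l) * F l = 1" for l
    unfolding Q_def F_def by (rule binomial_geometric_fps)
  have split: "prod Q L = Q l * prod Q (L - {l})" if "l \<in> L" for l
    using that assms(1) by (rule prod.remove[rotated])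
  have "Abs_fps (\<lambda>m. \<Sum>l\<in>L. c l * (of_nat ((m + r - 1) choose m) * (- u l) ^ m)) =
      (\<Sum>l\<in>L. fps_const (c l) * F l)"
    by (rule fps_ext) (simp add: F_def fps_sum_nth)
  then have "fps_of_poly (prod Q L) *
      Abs_fps (\<lambda>m. \<Sum>l\<in>L. c l * (of_nat ((m + r - 1) choose m) * (- u l) ^ m)) =
      (\<Sum>l\<in>L. fps_of_poly (prod Q L) * (fps_const (c l) * F l))"
    by (simp add: sum_distrib_left)
  also have "\<dots> = (\<Sum>l\<in>L. fps_of_poly (smult (c l) (prod Q (L - {l}))))"
  proof (intro sum.cong refl)
    fix l assume "l \<in> L"
    have "fps_of_poly (prod Q L) * (fps_const (c l) * F l) =
        (fps_of_poly (Q l) * F l) * (fps_const (c l) * fps_of_poly (prod Q (L - {l})))"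
      by (simp only: split[OF \<open>l \<in> L\<close>] fps_of_poly_mult mult_ac)
    then show "fps_of_poly (prod Q L) * (fps_const (c l) * F l) =
        fps_of_poly (smult (c l) (prod Q (L - {l})))"
      by (simp add: QF fps_of_poly_smult)
  qed
  also have "\<dots> = fps_of_poly (\<Sum>l\<in>L. smult (c l) (prod Q (L - {l})))"
    by (simp add: fps_of_poly_sum)
  finally have "rational_sum (\<lambda>m. \<Sum>l\<in>L. c l * (of_nat ((m + r - 1) choose m) * (- u l) ^ m)) =
      poly (\<Sum>l\<in>L. smult (c l) (prod Q (L - {l}))) 1 / poly (prod Q L) 1"
    using assms by (intro rational_sum_eqI) (auto simp: poly_prod Q1)
  also have "\<dots> = (\<Sum>l\<in>L. c l / (1 + u l) ^ r)"
    unfolding poly_sum sum_divide_distrib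
  proof (intro sum.cong refl)
    fix l assume "l \<in> L"
    have "poly (prod Q (L - {l})) 1 \<noteq> 0"
      using assms by (auto simp: poly_prod Q1)
    then show "poly (smult (c l) (prod Q (L - {l}))) 1 / poly (prod Q L) 1 = c l / (1 + u l) ^ r"
      by (simp add: split[OF \<open>l \<in> L\<close>] Q1)
  qed
  finally show ?thesis .
qed

section \<open>Closed forms and the distribution relation\<close>

context padic_field
begin

text \<open>An abstract \<open>e\<close> with a shift law lets the formula serve both
  \<open>zp_pow q\<close> and, with base \<open>q ^ d\<close>,
  \<open>zp_pow_base q d\<close>.\<close>

lemma qEuler_closed_form:
  fixes e :: "'a \<Rightarrow> 'a"
  assumes p: "odd p" and q: "absp (1 - q) < 1" and w: "absp (1 - w) < 1"
    and e: "\<And>s. e (y + of_nat s) = e y * q ^ s"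
  shows "qEuler p r n w q e y =
    (\<Sum>l\<le>n. of_nat (n choose l) * (- e y) ^ l / (1 - q) ^ n * (2 / (1 + w * q ^ l)) ^ r)"
  unfolding qEuler_def
proof (rule fermionic_integral_iter_exponential_sum[OF p])
  fix l
  show "absp (1 - w * q ^ l) < 1"
    using absp_one_minus_power_le[OF q, of l] q by (intro absp_one_minus_mult w) simp
next
  fix ks :: "nat list"
  have s: "sum_list (map of_nat ks) = (of_nat (sum_list ks) :: 'a)"
    by (induction ks) auto
  show "zp_pow w (sum_list (map of_nat ks)) * q_bracket q e (y + sum_list (map of_nat ks)) ^ n =
      (\<Sum>l\<le>n. of_nat (n choose l) * (- e y) ^ l / (1 - q) ^ n * (w * q ^ l) ^ sum_list ks)"
    unfolding s zp_pow_of_nat[OF w] q_bracket_power_expand[of e, OF e]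
    by (simp add: sum_distrib_left power_mult_distrib mult_ac)
qed

text \<open>The factor \<open>fps_X ^ r\<close> moves coefficient \<open>n + r\<close> to
  \<open>n\<close>, \<open>fps_exp\<close> supplies \<open>1 / fact n\<close>, and
  \<open>2 ^ r\<close> turns \<open>1 / (1 + w * q ^ l) ^ r\<close> into the integral's
  factor.\<close>

lemma qGenocchi_eq_qEuler:
  fixes e :: "'a \<Rightarrow> 'a"
  assumes p: "odd p" and q: "absp (1 - q) < 1" and w: "absp (1 - w) < 1"
    and e: "\<And>s. e (y + of_nat s) = e y * q ^ s"
  shows "qGenocchi r (n + r) w q e y = fact (n + r) / fact n * qEuler p r n w q e y"
proof -
  define c where "c l = of_nat (n choose l) * (- e y) ^ l / (1 - q) ^ n" for l
  have nz: "1 + w * q ^ l \<noteq> 0" for l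
    using absp_one_minus_power_le[OF q, of l] q
    by (intro one_plus_nonzero absp_one_minus_mult p w) simp
  have "of_nat ((m + r - 1) choose m) * (-1) ^ m * w ^ m *
        fps_nth (fps_exp (q_bracket q e (of_nat m + y))) n =
      (\<Sum>l\<le>n. c l / fact n * (of_nat ((m + r - 1) choose m) * (- (w * q ^ l)) ^ m))" for m
  proof -
    have "fps_nth (fps_exp (q_bracket q e (of_nat m + y))) n =
        q_bracket q e (y + of_nat m) ^ n / fact n"
      by (simp add: add.commute)
    also have "\<dots> = (\<Sum>l\<le>n. c l / fact n * (q ^ l) ^ m)"
      by (simp add: q_bracket_power_expand[of e, OF e] sum_divide_distrib c_def)
    finally show ?thesis
      by (simp add: sum_distrib_left power_minus[of "_ * _"] power_mult_distrib mult_ac)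
  qed
  then have sum: "rational_sum (\<lambda>m. of_nat ((m + r - 1) choose m) * (-1) ^ m * w ^ m *
        fps_nth (fps_exp (q_bracket q e (of_nat m + y))) n) =
      (\<Sum>l\<le>n. c l / fact n / (1 + w * q ^ l) ^ r)"
    using nz by (simp only:) (rule rational_sum_binomial_geometric, auto)
  have nth: "fps_nth (2 ^ r * fps_X ^ r * Abs_fps g) (n + r) = 2 ^ r * g n" for g :: "nat \<Rightarrow> 'a"
  proof -
    have "(2 :: 'a fps) ^ r = fps_const (2 ^ r)"
      by (simp only: numeral_fps_const fps_const_power)
    then show ?thesis by (simp only: mult.assoc fps_mult_left_const_nth fps_X_power_mult_nth) simp
  qed
  show ?thesis
    unfolding qGenocchi_def qGenocchi_gf_def nth sum qEuler_closed_form[of q w e, OF p q w e] c_def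
    by (simp add: sum_distrib_left sum_divide_distrib power_divide mult_ac)
qed

lemma qEuler_distribution:
  fixes q w x :: 'a
  assumes p: "odd p" and q: "absp (1 - q) < 1" and w: "absp (1 - w) < 1"
    and qd: "q ^ d \<noteq> 1" and x: "x \<in> Zp" and d: "odd d"
  shows "qEuler p r n w q (zp_pow q) x =
      q_bracket q (zp_pow q) (of_nat d) ^ n *
      (\<Sum>a\<in>{1..r} \<rightarrow>\<^sub>E {0..d - 1}.
         (\<Prod>i=1..r. w ^ a i) * (-1) ^ (\<Sum>i=1..r. a i) *
         qEuler p r n (w ^ d) (q ^ d) (zp_pow_base q d) ((of_nat (\<Sum>i=1..r. a i) + x) / of_nat d))"
proof -
  have qd1: "absp (1 - q ^ d) < 1" and wd1: "absp (1 - w ^ d) < 1"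
    using le_less_trans[OF absp_one_minus_power_le[OF q] q]
      le_less_trans[OF absp_one_minus_power_le[OF w] w] by blast+
  \<comment> \<open>The case \<open>q = 1\<close> is excluded too, since it would give
    \<open>q ^ d = 1\<close>.\<close>
  have q1: "1 - q \<noteq> 0" "1 - q ^ d \<noteq> 0" using qd by auto
  define X where "X = zp_pow q x"
  define b where "b l = of_nat (n choose l) * (- X) ^ l / (1 - q ^ d) ^ n" for l
  define T where "T l = (2 / (1 + w ^ d * (q ^ d) ^ l)) ^ r" for l
  define P where "P = {1..r} \<rightarrow>\<^sub>E {0..d - 1}"
  \<comment> \<open>For each \<open>l\<close> the dependence on \<open>a\<close> splits into one
    factor per coordinate, which prepares the sum over the box \<open>P\<close>.\<close>
  have summand: "(\<Prod>i=1..r. w ^ a i) * (-1) ^ (\<Sum>i=1..r. a i) *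
      qEuler p r n (w ^ d) (q ^ d) (zp_pow_base q d) ((of_nat (\<Sum>i=1..r. a i) + x) / of_nat d) =
      (\<Sum>l\<le>n. b l * T l * (\<Prod>i=1..r. (- (w * q ^ l)) ^ a i))" for a :: "nat \<Rightarrow> nat"
  proof -
    define S where "S = (\<Sum>i=1..r. a i)"
    define y where "y = (of_nat S + x) / of_nat d"
    have e: "zp_pow_base q d (y + of_nat s) = X * q ^ (S + d * s)" for s
      unfolding y_def X_def by (rule zp_pow_base_quotient[OF q x odd_pos[OF d]])
    have e0: "zp_pow_base q d y = X * q ^ S" using e[of 0] by simp
    have "qEuler p r n (w ^ d) (q ^ d) (zp_pow_base q d) y =
        (\<Sum>l\<le>n. of_nat (n choose l) * (- (X * q ^ S)) ^ l / (1 - q ^ d) ^ n * T l)"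
      unfolding T_def e0 [symmetric]
      by (intro qEuler_closed_form p qd1 wd1) (simp add: e e0 power_add power_mult)
    also have "\<dots> = (\<Sum>l\<le>n. b l * T l * (q ^ l) ^ S)"
      by (simp add: b_def power_minus[of "_ * _"] power_minus[of X] power_mult_distrib
          power_mult [symmetric] mult_ac)
    finally have "w ^ S * (-1) ^ S * qEuler p r n (w ^ d) (q ^ d) (zp_pow_base q d) y =
        (\<Sum>l\<le>n. b l * T l * (- (w * q ^ l)) ^ S)"
      by (simp add: sum_distrib_left power_minus[of "_ * _"] power_mult_distrib mult_ac)
    then show ?thesis by (simp add: y_def S_def power_sum)
  qed
  \<comment> \<open>A product summed over a box is a product of one-variable sums; the sign of
    \<open>v ^ d\<close> comes from \<open>d\<close> being odd.\<close>
  have geometric: "(\<Sum>a\<in>P. \<Prod>i=1..r. (- v) ^ a i) = ((1 + v ^ d) / (1 + v)) ^ r"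
    if "1 + v \<noteq> 0" for v :: 'a
  proof -
    have "{0..d - 1} = {..<d}" using d by (cases d) auto
    then have "(\<Sum>a\<in>P. \<Prod>i=1..r. (- v) ^ a i) = (\<Sum>k<d. (- v) ^ k) ^ r"
      unfolding P_def by (subst prod_sum_PiE [symmetric]) auto
    moreover have "1 - (- v) ^ d = (1 + v) * (\<Sum>k<d. (- v) ^ k)"
      by (simp add: one_diff_power_eq)
    ultimately show ?thesis using that d by simp
  qed
  have wq: "absp (1 - w * q ^ l) < 1" for l
    using absp_one_minus_power_le[OF q, of l] q by (intro absp_one_minus_mult w) simp
  have nz: "1 + w * q ^ l \<noteq> 0" "1 + (w * q ^ l) ^ d \<noteq> 0" for l
    using one_plus_nonzero[OF p wq]
      one_plus_nonzero[OF p le_less_trans[OF absp_one_minus_power_le[OF wq] wq]] by blast+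
  have "(\<Sum>a\<in>P. \<Sum>l\<le>n. b l * T l * (\<Prod>i=1..r. (- (w * q ^ l)) ^ a i)) =
      (\<Sum>l\<le>n. b l * T l * ((1 + (w * q ^ l) ^ d) / (1 + w * q ^ l)) ^ r)"
    by (subst sum.swap) (simp only: sum_distrib_left [symmetric] geometric[OF nz(1)])
  also have "\<dots> = (\<Sum>l\<le>n. b l * (2 / (1 + w * q ^ l)) ^ r)"
  proof (intro sum.cong refl)
    fix l
    have "w ^ d * (q ^ d) ^ l = (w * q ^ l) ^ d"
      by (simp add: power_mult_distrib power_mult [symmetric] mult.commute)
    then have "T l * ((1 + (w * q ^ l) ^ d) / (1 + w * q ^ l)) ^ r = (2 / (1 + w * q ^ l)) ^ r"
      using nz[of l] unfolding T_def by (simp add: power_divide)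
    then show "b l * T l * ((1 + (w * q ^ l) ^ d) / (1 + w * q ^ l)) ^ r =
        b l * (2 / (1 + w * q ^ l)) ^ r" by (simp only: mult.assoc)
  qed
  finally have rhs: "(\<Sum>a\<in>P. \<Sum>l\<le>n. b l * T l * (\<Prod>i=1..r. (- (w * q ^ l)) ^ a i)) =
      (\<Sum>l\<le>n. b l * (2 / (1 + w * q ^ l)) ^ r)" .
  have "qEuler p r n w q (zp_pow q) x =
      (\<Sum>l\<le>n. of_nat (n choose l) * (- X) ^ l / (1 - q) ^ n * (2 / (1 + w * q ^ l)) ^ r)"
    unfolding X_def by (intro qEuler_closed_form p q w zp_pow_add_of_nat x)
  \<comment> \<open>Exchanging the denominator \<open>(1 - q) ^ n\<close> for the
    \<open>(1 - q ^ d) ^ n\<close> inside \<open>b\<close> produces the bracket of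
    \<open>d\<close>.\<close>
  also have "\<dots> = ((1 - q ^ d) / (1 - q)) ^ n * (\<Sum>l\<le>n. b l * (2 / (1 + w * q ^ l)) ^ r)"
    using q1 by (simp add: sum_distrib_left b_def power_divide mult.assoc)
  finally show ?thesis
    unfolding summand P_def [symmetric] rhs by (simp add: q_bracket_def zp_pow_of_nat[OF q])
qed

end

theorem theorem6:
  fixes p r n d :: nat and q w x :: "'a::{field_char_0,complete_space}"
  assumes "is_Cp p TYPE('a)" and "odd p"
    and "absp (1 - q) < 1" and "absp (1 - w) < 1"
    and "q ^ d \<noteq> 1"
    and "r \<ge> 1" and "x \<in> Zp" and "odd d"
  shows "qEuler p r n w q (zp_pow q) x =
      q_bracket q (zp_pow q) (of_nat d) ^ n *
      (\<Sum>a\<in>{1..r} \<rightarrow>\<^sub>E {0..d - 1}.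
         (\<Prod>i=1..r. w ^ a i) * (-1) ^ (\<Sum>i=1..r. a i) *
         qEuler p r n (w ^ d) (q ^ d) (zp_pow_base q d) ((of_nat (\<Sum>i=1..r. a i) + x) / of_nat d))
    \<and> qGenocchi r (n + r) w q (zp_pow q) x =
      q_bracket q (zp_pow q) (of_nat d) ^ n *
      (\<Sum>a\<in>{1..r} \<rightarrow>\<^sub>E {0..d - 1}.
         (\<Prod>i=1..r. w ^ a i) * (-1) ^ (\<Sum>i=1..r. a i) *
         qGenocchi r (n + r) (w ^ d) (q ^ d) (zp_pow_base q d) ((of_nat (\<Sum>i=1..r. a i) + x) / of_nat d))"
proof -
  interpret padic_field p "TYPE('a)"
    using assms(1) unfolding is_Cp_def by unfold_locales blast+
  note q = assms(3) and w = assms(4) and x = assms(7)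
  have qd1: "absp (1 - q ^ d) < 1" and wd1: "absp (1 - w ^ d) < 1"
    using le_less_trans[OF absp_one_minus_power_le[OF q] q]
      le_less_trans[OF absp_one_minus_power_le[OF w] w] by blast+
  \<comment> \<open>The shift law for base \<open>q ^ d\<close>, obtained by comparing shift
    \<open>s\<close> with shift 0.\<close>
  have e: "zp_pow_base q d ((of_nat S + x) / of_nat d + of_nat s) =
      zp_pow_base q d ((of_nat S + x) / of_nat d) * (q ^ d) ^ s" for S s
    using zp_pow_base_quotient[OF q x odd_pos[OF assms(8)], of S s]
      zp_pow_base_quotient[OF q x odd_pos[OF assms(8)], of S 0]
    by (simp add: power_add power_mult)
  note euler = qEuler_distribution[OF assms(2) q w assms(5) x assms(8), of r n]
  have "qGenocchi r (n + r) w q (zp_pow q) x =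
      fact (n + r) / fact n * qEuler p r n w q (zp_pow q) x"
    by (intro qGenocchi_eq_qEuler assms(2) q w zp_pow_add_of_nat x)
  moreover have "qGenocchi r (n + r) (w ^ d) (q ^ d) (zp_pow_base q d) ((of_nat S + x) / of_nat d) =
      fact (n + r) / fact n *
      qEuler p r n (w ^ d) (q ^ d) (zp_pow_base q d) ((of_nat S + x) / of_nat d)" for S
    by (intro qGenocchi_eq_qEuler assms(2) qd1 wd1 e)
  \<comment> \<open>The factor \<open>fact (n + r) / fact n\<close> depends on neither
    \<open>a\<close> nor the base, so it passes through the Euler identity.\<close>
  ultimately have "qGenocchi r (n + r) w q (zp_pow q) x =
      q_bracket q (zp_pow q) (of_nat d) ^ n *
      (\<Sum>a\<in>{1..r} \<rightarrow>\<^sub>E {0..d - 1}.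
         (\<Prod>i=1..r. w ^ a i) * (-1) ^ (\<Sum>i=1..r. a i) *
         qGenocchi r (n + r) (w ^ d) (q ^ d) (zp_pow_base q d) ((of_nat (\<Sum>i=1..r. a i) + x) / of_nat d))"
    unfolding euler by (simp only: sum_distrib_left mult_ac)
  with euler show ?thesis by blast
qed

end
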